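(* Let $(M,J,g)$ be an almost Norden manifold, let $\nabla^0$ be the Levi-Civita connection of $g$, and let $\nabla^\ast_XY=\nabla^0_XY-J(\nabla^0_XJ)Y$ be its conjugate connection relative to $\widetilde g$ and $J$. Let $P$ be the average curvature tensor of $\nabla^0$ and $\nabla^\ast$, and let $K$ be the curvature tensor of their average connection $D$. Then for all $X,Y,Z,W$, $$g(K(X,Y)Z,W)=g(P(X,Y)Z,W)+\tfrac14\big\{g\big((\nabla^0_XJ)Z,(\nabla^0_YJ)W\big)-g\big((\nabla^0_XJ)W,(\nabla^0_YJ)Z\big)\big\}.$$
   Context: An almost Norden manifold $(M,J,g)$ is a differentiable $2n$-dimensional manifold $M$ with an almost complex structure $J$ ($J^2=-\mathrm{id}$) and a pseudo-Riemannian metric $g$ such that $g(JX,JY)=-g(X,Y)$; $\widetilde g(X,Y)=g(X,JY)$ is its associated metric. The curvature tensor of a linear connection $\nabla$ is $R(X,Y)Z=\nabla_X\nabla_YZ-\nabla_Y\nabla_XZ-\nabla_{[X,Y]}Z$. Let $R^0,R^\ast$ be the curvature tensors of $\nabla^0,\nabla^\ast$. The average curvature tensor is $P(X,Y)Z=\frac12\{R^0(X,Y)Z+R^\ast(X,Y)Z\}$. The average connection is $D=\frac12(\nabla^0+\nabla^\ast)$, i.e. $D_XY=\nabla^0_XY-\frac12J(\nabla^0_XJ)Y$. *)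

theory Defs
  imports "HOL-Analysis.Analysis" "HOL-Library.Function_Algebras"
begin

section \<open>Smooth manifolds\<close>

primrec Ck_on :: "nat \<Rightarrow> 'e set \<Rightarrow> ('e::real_normed_vector \<Rightarrow> 'f::real_normed_vector) \<Rightarrow> bool" where
  "Ck_on 0 S f \<longleftrightarrow> continuous_on S f"
| "Ck_on (Suc k) S f \<longleftrightarrow> (\<forall>x\<in>S. f differentiable (at x)) \<and>
     (\<forall>v. Ck_on k S (\<lambda>x. frechet_derivative f (at x) v))"

text \<open>
  Derivatives are two-sided, so these notions are only meaningful for open \<^term>\<open>S\<close>.
\<close>

definition smooth_on :: "'e set \<Rightarrow> ('e::real_normed_vector \<Rightarrow> 'f::real_normed_vector) \<Rightarrow> bool" where
  "smooth_on S f \<longleftrightarrow> (\<forall>k. Ck_on k S f)"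

text \<open>
  The underlying set of the manifold is the whole type \<^typ>\<open>'a\<close>, whose type class supplies the
  Hausdorff and second countability axioms. Charts take values in a Euclidean space
  \<^typ>\<open>'e\<close>, so the dimension of the manifold is \<open>DIM('e)\<close>.
\<close>

type_synonym ('a, 'e) chart = "'a set \<times> ('a \<Rightarrow> 'e)"

definition is_chart :: "('a::topological_space, 'e::euclidean_space) chart \<Rightarrow> bool" where
  "is_chart c \<longleftrightarrow> (case c of (U, \<phi>) \<Rightarrow>
     open U \<and> open (\<phi> ` U) \<and> homeomorphism U (\<phi> ` U) \<phi> (inv_into U \<phi>))"

text \<open>
  The atlas need not be maximal: the smooth functions with respect to an atlas and with respect to
  the maximal atlas containing it are the same.
\<close>

locale smooth_manifold =
  fixes A :: "('a::{t2_space,second_countable_topology}, 'e::euclidean_space) chart set"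
  assumes charts: "\<And>c. c \<in> A \<Longrightarrow> is_chart c"
    and cover: "(\<Union>c\<in>A. fst c) = UNIV"
    and transition: "\<And>U \<phi> V \<psi>. (U, \<phi>) \<in> A \<Longrightarrow> (V, \<psi>) \<in> A \<Longrightarrow>
      smooth_on (\<phi> ` (U \<inter> V)) (\<psi> \<circ> inv_into U \<phi>)"

definition smooth_functions ::
    "('a::topological_space, 'e::euclidean_space) chart set \<Rightarrow> ('a \<Rightarrow> real) set" where
  "smooth_functions A = {f. \<forall>(U, \<phi>)\<in>A. smooth_on (\<phi> ` U) (f \<circ> inv_into U \<phi>)}"

section \<open>Tangent vectors and vector fields\<close>

text \<open>
  A tangent vector at \<open>p\<close> is a derivation at \<open>p\<close> of the algebra of smooth functions. It is
  required to vanish off the smooth functions, so that tangent vectors are equal as HOL functions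
  if and only if they agree on all smooth functions.
\<close>

type_synonym 'a tvec = "('a \<Rightarrow> real) \<Rightarrow> real"
type_synonym 'a vfield = "'a \<Rightarrow> 'a tvec"

definition tangent_space ::
    "('a::topological_space, 'e::euclidean_space) chart set \<Rightarrow> 'a \<Rightarrow> 'a tvec set" where
  "tangent_space A p = {v.
     (\<forall>f\<in>smooth_functions A. \<forall>h\<in>smooth_functions A. v (f + h) = v f + v h) \<and>
     (\<forall>f\<in>smooth_functions A. \<forall>c. v (\<lambda>q. c * f q) = c * v f) \<and>
     (\<forall>f\<in>smooth_functions A. \<forall>h\<in>smooth_functions A. v (f * h) = v f * h p + f p * v h) \<and>
     (\<forall>f. f \<notin> smooth_functions A \<longrightarrow> v f = 0)}"

text \<open>
  Addition and subtraction of tangent vectors and of vector fields are the pointwise operations on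
  functions.
\<close>

definition tscale :: "real \<Rightarrow> 'a tvec \<Rightarrow> 'a tvec" where
  "tscale c v = (\<lambda>f. c * v f)"

definition fscale :: "('a \<Rightarrow> real) \<Rightarrow> 'a vfield \<Rightarrow> 'a vfield" where
  "fscale f X = (\<lambda>p. tscale (f p) (X p))"

definition deriv_along :: "'a vfield \<Rightarrow> ('a \<Rightarrow> real) \<Rightarrow> ('a \<Rightarrow> real)" where
  "deriv_along X f = (\<lambda>p. X p f)"

definition vector_fields ::
    "('a::topological_space, 'e::euclidean_space) chart set \<Rightarrow> 'a vfield set" where
  "vector_fields A = {X. (\<forall>p. X p \<in> tangent_space A p) \<and>
     (\<forall>f\<in>smooth_functions A. deriv_along X f \<in> smooth_functions A)}"

definition lie_bracket :: "'a vfield \<Rightarrow> 'a vfield \<Rightarrow> 'a vfield" where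
  "lie_bracket X Y = (\<lambda>p f. X p (deriv_along Y f) - Y p (deriv_along X f))"

section \<open>Almost Norden manifolds\<close>

definition endo_app :: "('a \<Rightarrow> 'a tvec \<Rightarrow> 'a tvec) \<Rightarrow> 'a vfield \<Rightarrow> 'a vfield" where
  "endo_app J X = (\<lambda>p. J p (X p))"

definition metric_app :: "('a \<Rightarrow> 'a tvec \<Rightarrow> 'a tvec \<Rightarrow> real) \<Rightarrow> 'a vfield \<Rightarrow> 'a vfield \<Rightarrow> 'a \<Rightarrow> real" where
  "metric_app g X Y = (\<lambda>p. g p (X p) (Y p))"

text \<open>
  Smoothness of a tensor field is expressed by its taking smooth vector fields to smooth vector
  fields, respectively to smooth functions.
\<close>

locale almost_complex_structure = smooth_manifold A
  for A :: "('a::{t2_space,second_countable_topology}, 'e::euclidean_space) chart set" +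
  fixes J :: "'a \<Rightarrow> 'a tvec \<Rightarrow> 'a tvec"
  assumes J_tangent: "\<And>p v. v \<in> tangent_space A p \<Longrightarrow> J p v \<in> tangent_space A p"
    and J_add: "\<And>p u v. u \<in> tangent_space A p \<Longrightarrow> v \<in> tangent_space A p \<Longrightarrow>
      J p (u + v) = J p u + J p v"
    and J_scale: "\<And>p c v. v \<in> tangent_space A p \<Longrightarrow> J p (tscale c v) = tscale c (J p v)"
    and J_smooth: "\<And>X. X \<in> vector_fields A \<Longrightarrow> endo_app J X \<in> vector_fields A"
    and J_square: "\<And>p v. v \<in> tangent_space A p \<Longrightarrow> J p (J p v) = - v"

locale pseudo_riemannian_metric = smooth_manifold A
  for A :: "('a::{t2_space,second_countable_topology}, 'e::euclidean_space) chart set" +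
  fixes g :: "'a \<Rightarrow> 'a tvec \<Rightarrow> 'a tvec \<Rightarrow> real"
  assumes g_sym: "\<And>p u v. u \<in> tangent_space A p \<Longrightarrow> v \<in> tangent_space A p \<Longrightarrow> g p u v = g p v u"
    and g_add: "\<And>p u v w. u \<in> tangent_space A p \<Longrightarrow> v \<in> tangent_space A p \<Longrightarrow>
      w \<in> tangent_space A p \<Longrightarrow> g p (u + v) w = g p u w + g p v w"
    and g_scale: "\<And>p c u v. u \<in> tangent_space A p \<Longrightarrow> v \<in> tangent_space A p \<Longrightarrow>
      g p (tscale c u) v = c * g p u v"
    and g_nondegenerate: "\<And>p u. u \<in> tangent_space A p \<Longrightarrow>
      (\<forall>v\<in>tangent_space A p. g p u v = 0) \<Longrightarrow> u = 0"
    and g_smooth: "\<And>X Y. X \<in> vector_fields A \<Longrightarrow> Y \<in> vector_fields A \<Longrightarrow>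
      metric_app g X Y \<in> smooth_functions A"

text \<open>
  The signature is not an axiom: the last condition below makes \<open>J\<close> exchange the positive and the
  negative definite subspaces, which forces signature \<open>(n, n)\<close> at every point.
\<close>

locale almost_norden_manifold =
  almost_complex_structure A J + pseudo_riemannian_metric A g
  for A :: "('a::{t2_space,second_countable_topology}, 'e::euclidean_space) chart set"
    and J :: "'a \<Rightarrow> 'a tvec \<Rightarrow> 'a tvec"
    and g :: "'a \<Rightarrow> 'a tvec \<Rightarrow> 'a tvec \<Rightarrow> real" +
  fixes n :: nat
  assumes dimension: "DIM('e) = 2 * n"
    and norden: "\<And>p u v. u \<in> tangent_space A p \<Longrightarrow> v \<in> tangent_space A p \<Longrightarrow>
      g p (J p u) (J p v) = - g p u v"

section \<open>Connections and curvature\<close>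

type_synonym 'a connection = "'a vfield \<Rightarrow> 'a vfield \<Rightarrow> 'a vfield"

locale linear_connection = smooth_manifold A
  for A :: "('a::{t2_space,second_countable_topology}, 'e::euclidean_space) chart set" +
  fixes nabla :: "'a connection"
  assumes nabla_field: "\<And>X Y. X \<in> vector_fields A \<Longrightarrow> Y \<in> vector_fields A \<Longrightarrow>
      nabla X Y \<in> vector_fields A"
    and nabla_add_left: "\<And>X X' Y. X \<in> vector_fields A \<Longrightarrow> X' \<in> vector_fields A \<Longrightarrow>
      Y \<in> vector_fields A \<Longrightarrow> nabla (X + X') Y = nabla X Y + nabla X' Y"
    and nabla_scale_left: "\<And>f X Y. f \<in> smooth_functions A \<Longrightarrow> X \<in> vector_fields A \<Longrightarrow>
      Y \<in> vector_fields A \<Longrightarrow> nabla (fscale f X) Y = fscale f (nabla X Y)"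
    and nabla_add_right: "\<And>X Y Y'. X \<in> vector_fields A \<Longrightarrow> Y \<in> vector_fields A \<Longrightarrow>
      Y' \<in> vector_fields A \<Longrightarrow> nabla X (Y + Y') = nabla X Y + nabla X Y'"
    and nabla_leibniz: "\<And>f X Y. f \<in> smooth_functions A \<Longrightarrow> X \<in> vector_fields A \<Longrightarrow>
      Y \<in> vector_fields A \<Longrightarrow>
      nabla X (fscale f Y) = fscale (deriv_along X f) Y + fscale f (nabla X Y)"

locale levi_civita_connection =
  pseudo_riemannian_metric A g + linear_connection A nabla
  for A :: "('a::{t2_space,second_countable_topology}, 'e::euclidean_space) chart set"
    and g :: "'a \<Rightarrow> 'a tvec \<Rightarrow> 'a tvec \<Rightarrow> real"
    and nabla :: "'a connection" +
  assumes torsion_free: "\<And>X Y. X \<in> vector_fields A \<Longrightarrow> Y \<in> vector_fields A \<Longrightarrow>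
      nabla X Y - nabla Y X = lie_bracket X Y"
    and metric_compatible: "\<And>X Y Z. X \<in> vector_fields A \<Longrightarrow> Y \<in> vector_fields A \<Longrightarrow>
      Z \<in> vector_fields A \<Longrightarrow>
      deriv_along X (metric_app g Y Z) =
        metric_app g (nabla X Y) Z + metric_app g Y (nabla X Z)"

text \<open>\<open>cov_deriv_endo nabla J X Y\<close> is \<open>(\<nabla>\<^sub>X J) Y\<close>.\<close>

definition cov_deriv_endo ::
    "'a connection \<Rightarrow> ('a \<Rightarrow> 'a tvec \<Rightarrow> 'a tvec) \<Rightarrow> 'a vfield \<Rightarrow> 'a vfield \<Rightarrow> 'a vfield" where
  "cov_deriv_endo nabla J X Y = nabla X (endo_app J Y) - endo_app J (nabla X Y)"

text \<open>
  For the Levi-Civita connection \<open>\<nabla>\<close> of \<open>g\<close>, the conjugate \<open>\<nabla>'\<close> satisfies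
  \<open>X (h(Y, Z)) = h(\<nabla>\<^sub>X Y, Z) + h(Y, \<nabla>'\<^sub>X Z)\<close> for the associated metric \<open>h(Y, Z) = g(Y, J Z)\<close>.
\<close>

definition conjugate_connection ::
    "('a \<Rightarrow> 'a tvec \<Rightarrow> 'a tvec) \<Rightarrow> 'a connection \<Rightarrow> 'a connection" where
  "conjugate_connection J nabla =
     (\<lambda>X Y. nabla X Y - endo_app J (cov_deriv_endo nabla J X Y))"

definition average_connection :: "'a connection \<Rightarrow> 'a connection \<Rightarrow> 'a connection" where
  "average_connection nabla nabla' = (\<lambda>X Y. fscale (\<lambda>p. 1 / 2) (nabla X Y + nabla' X Y))"

definition curvature :: "'a connection \<Rightarrow> 'a vfield \<Rightarrow> 'a vfield \<Rightarrow> 'a vfield \<Rightarrow> 'a vfield" where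
  "curvature nabla X Y Z =
     nabla X (nabla Y Z) - nabla Y (nabla X Z) - nabla (lie_bracket X Y) Z"

definition average_curvature ::
    "'a connection \<Rightarrow> 'a connection \<Rightarrow> 'a vfield \<Rightarrow> 'a vfield \<Rightarrow> 'a vfield \<Rightarrow> 'a vfield" where
  "average_curvature nabla nabla' =
     (\<lambda>X Y Z. fscale (\<lambda>p. 1 / 2) (curvature nabla X Y Z + curvature nabla' X Y Z))"

end

theory Submission
  imports Defs
begin

text \<open>
  Two connections with difference tensor \<open>T = \<nabla>' - \<nabla>\<close> satisfy \<open>K = P - 1/4 [T\<^sub>X, T\<^sub>Y]\<close>, because
  the terms of the curvature of \<open>\<nabla> + t T\<close> that are not quadratic in \<open>t\<close> are affine in \<open>t\<close>.
  Here \<open>T\<^sub>X = - J (\<nabla>\<^sub>X J)\<close>. Since \<open>\<nabla>\<^sub>X J\<close> anticommutes with \<open>J\<close>, the two factors \<open>J\<close> cancel in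
  \<open>T\<^sub>X T\<^sub>Y = (\<nabla>\<^sub>X J) (\<nabla>\<^sub>Y J)\<close>, and the claim follows from the self-adjointness of \<open>\<nabla>\<^sub>X J\<close>
  with respect to \<open>g\<close>, which \<open>\<nabla>\<^sub>X J\<close> inherits from \<open>J\<close>.
\<close>

section \<open>Smooth functions on open sets\<close>

text \<open>Openness makes a function's values on \<open>S\<close> determine its derivative at each
  point of \<open>S\<close>, so the induction can pass from \<open>f\<close> and \<open>h\<close> to
  their derivatives.\<close>

lemma Ck_on_cong:
  assumes "open S" "\<And>x. x \<in> S \<Longrightarrow> f x = h x" "Ck_on k S f"
  shows "Ck_on k S h"
  using assms(2,3)
proof (induction k arbitrary: f h)
  case 0
  then show ?case by (simp cong: continuous_on_cong)
next
  case (Suc k)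
  have der: "(h has_derivative frechet_derivative f (at x)) (at x)" if "x \<in> S" for x
  proof -
    have "(f has_derivative frechet_derivative f (at x)) (at x)"
      using Suc.prems(2) that by (simp add: frechet_derivative_works)
    then show ?thesis
      using has_derivative_transform_within_open[OF _ assms(1) that] Suc.prems(1) by blast
  qed
  have "frechet_derivative f (at x) = frechet_derivative h (at x)" if "x \<in> S" for x
    using frechet_derivative_at[OF der[OF that]] .
  then have "Ck_on k S (\<lambda>x. frechet_derivative h (at x) v)" for v
    using Suc.IH[of "\<lambda>x. frechet_derivative f (at x) v" "\<lambda>x. frechet_derivative h (at x) v"]
      Suc.prems(2) by simp
  then show ?case
    using der by (auto simp: differentiable_def)
qed

lemma Ck_on_const: "Ck_on k S (\<lambda>x. c)"
  by (induction k arbitrary: c) auto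

lemma Ck_on_linear_combination:
  assumes "open S" "Ck_on k S f" "Ck_on k S h"
  shows "Ck_on k S (\<lambda>x. a *\<^sub>R f x + b *\<^sub>R h x)"
  using assms(2,3)
proof (induction k arbitrary: f h)
  case 0
  then show ?case by (auto intro!: continuous_intros)
next
  case (Suc k)
  have der: "((\<lambda>x. a *\<^sub>R f x + b *\<^sub>R h x) has_derivative
      (\<lambda>v. a *\<^sub>R frechet_derivative f (at x) v + b *\<^sub>R frechet_derivative h (at x) v)) (at x)"
    if "x \<in> S" for x
    using Suc.prems that
    by (auto intro!: derivative_intros simp: frechet_derivative_works[symmetric])
  have "Ck_on k S (\<lambda>x. frechet_derivative (\<lambda>x. a *\<^sub>R f x + b *\<^sub>R h x) (at x) v)" for v
  \<comment> \<open>The formula for the derivative is available only at points of \<open>S\<close>,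
    where \<open>f\<close> and \<open>h\<close> are differentiable; hence a congruence on
    \<open>S\<close> instead of an equality of functions.\<close>
  proof (rule Ck_on_cong[OF assms(1)])
    show "Ck_on k S (\<lambda>x. a *\<^sub>R frechet_derivative f (at x) v + b *\<^sub>R frechet_derivative h (at x) v)"
      using Suc by simp
    show "a *\<^sub>R frechet_derivative f (at x) v + b *\<^sub>R frechet_derivative h (at x) v =
        frechet_derivative (\<lambda>x. a *\<^sub>R f x + b *\<^sub>R h x) (at x) v" if "x \<in> S" for x
      using fun_cong[OF frechet_derivative_at[OF der[OF that]]] .
  qed
  then show ?case
    using der by (auto simp: differentiable_def)
qed

lemma const_smooth: "(\<lambda>p. c) \<in> smooth_functions A"
  by (auto simp: smooth_functions_def smooth_on_def comp_def Ck_on_const)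

section \<open>Tangent vectors and smooth vector fields\<close>

lemma tscale_apply [simp]: "tscale c v f = c * v f"
  by (simp add: tscale_def)

lemma fscale_apply [simp]: "fscale f X p = tscale (f p) (X p)"
  by (simp add: fscale_def)

lemma deriv_along_apply [simp]: "deriv_along X f p = X p f"
  by (simp add: deriv_along_def)

lemma endo_app_apply [simp]: "endo_app J X p = J p (X p)"
  by (simp add: endo_app_def)

lemma tscale_minus_one: "tscale (-1) v = - v"
  by (simp add: fun_eq_iff)

lemma tangent_space_add:
  "u \<in> tangent_space A p \<Longrightarrow> v \<in> tangent_space A p \<Longrightarrow> u + v \<in> tangent_space A p"
  by (simp add: tangent_space_def algebra_simps)

lemma tangent_space_scale: "v \<in> tangent_space A p \<Longrightarrow> tscale c v \<in> tangent_space A p"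
  by (simp add: tangent_space_def algebra_simps)

lemma tangent_space_uminus: "v \<in> tangent_space A p \<Longrightarrow> - v \<in> tangent_space A p"
  using tangent_space_scale[of v A p "-1"] by (simp add: tscale_minus_one)

text \<open>By the product rule, 1 = 1 * 1 gives v(1) = 2 v(1), so v(1) = 0; homogeneity extends
  this to every constant.\<close>

lemma tangent_space_const:
  assumes "v \<in> tangent_space A p"
  shows "v (\<lambda>q. c) = 0"
proof -
  have one: "(\<lambda>q. 1) \<in> smooth_functions A"
    by (rule const_smooth)
  have "v ((\<lambda>q. 1) * (\<lambda>q. 1)) = v (\<lambda>q. 1) * 1 + 1 * v (\<lambda>q. 1)"
    using assms one unfolding tangent_space_def by blast
  then have "v (\<lambda>q. 1) = 0"
    by (simp add: times_fun_def)
  moreover have "\<forall>f\<in>smooth_functions A. \<forall>c. v (\<lambda>q. c * f q) = c * v f"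
    using assms by (simp add: tangent_space_def)
  from bspec[OF this one] have "v (\<lambda>q. c * 1) = c * v (\<lambda>q. 1)"
    by blast
  ultimately show ?thesis
    by simp
qed

lemma vector_fields_tangent: "X \<in> vector_fields A \<Longrightarrow> X p \<in> tangent_space A p"
  by (simp add: vector_fields_def)

context smooth_manifold
begin

lemma smooth_functions_linear_combination:
  assumes "f \<in> smooth_functions A" "h \<in> smooth_functions A"
  shows "(\<lambda>p. a * f p + b * h p) \<in> smooth_functions A"
  unfolding smooth_functions_def
proof (clarsimp)
  fix U \<phi>
  assume c: "(U, \<phi>) \<in> A"
  then have "open (\<phi> ` U)"
    using charts by (auto simp: is_chart_def)
  moreover have "smooth_on (\<phi> ` U) (f \<circ> inv_into U \<phi>)" "smooth_on (\<phi> ` U) (h \<circ> inv_into U \<phi>)"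
    using assms c by (auto simp: smooth_functions_def)
  ultimately show "smooth_on (\<phi> ` U) ((\<lambda>p. a * f p + b * h p) \<circ> inv_into U \<phi>)"
    using Ck_on_linear_combination[of "\<phi> ` U" _ "f \<circ> inv_into U \<phi>" "h \<circ> inv_into U \<phi>" a b]
    by (simp add: smooth_on_def comp_def)
qed

lemma vector_fields_add:
  assumes "X \<in> vector_fields A" "Y \<in> vector_fields A"
  shows "X + Y \<in> vector_fields A"
proof -
  have "deriv_along (X + Y) f \<in> smooth_functions A" if "f \<in> smooth_functions A" for f
    using smooth_functions_linear_combination[of "deriv_along X f" "deriv_along Y f" 1 1] assms that
    by (simp add: vector_fields_def deriv_along_def)
  then show ?thesis
    using assms by (simp add: vector_fields_def tangent_space_add)
qed

lemma vector_fields_scale: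
  assumes "X \<in> vector_fields A"
  shows "fscale (\<lambda>p. c) X \<in> vector_fields A"
proof -
  have "deriv_along (fscale (\<lambda>p. c) X) f \<in> smooth_functions A" if "f \<in> smooth_functions A" for f
    using smooth_functions_linear_combination[of "deriv_along X f" "deriv_along X f" c 0] assms that
    by (simp add: vector_fields_def deriv_along_def)
  then show ?thesis
    using assms by (simp add: vector_fields_def tangent_space_scale)
qed

lemma vector_fields_diff:
  assumes "X \<in> vector_fields A" "Y \<in> vector_fields A"
  shows "X - Y \<in> vector_fields A"
proof -
  have eq: "X - Y = X + fscale (\<lambda>p. -1) Y"
    by (simp add: fun_eq_iff)
  show ?thesis
    unfolding eq using assms by (intro vector_fields_add vector_fields_scale)
qed

end

section \<open>Linear connections and the curvature of their average\<close>

context linear_connection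
begin

lemma nabla_diff_right:
  assumes "X \<in> vector_fields A" "Y \<in> vector_fields A" "Y' \<in> vector_fields A"
  shows "nabla X (Y - Y') = nabla X Y - nabla X Y'"
  using nabla_add_right[of X "Y - Y'" Y'] assms vector_fields_diff by simp

text \<open>The derivative term of the Leibniz rule vanishes, since tangent vectors kill
  constants.\<close>

lemma nabla_scale_right:
  assumes "X \<in> vector_fields A" "Y \<in> vector_fields A"
  shows "nabla X (fscale (\<lambda>p. c) Y) = fscale (\<lambda>p. c) (nabla X Y)"
  using nabla_leibniz[of "\<lambda>p. c" X Y] assms const_smooth[of c A]
    tangent_space_const[OF vector_fields_tangent[OF assms(1)]]
  by (simp add: fun_eq_iff)

end

text \<open>The average is \<open>nabla\<close> + t \<open>T\<close> at t = 1/2, while the average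
  curvature is the mean of the values at t = 0 and t = 1. The affine part agrees; the coefficient of
  the quadratic part is 1/4 on one side and 1/2 on the other, a difference of -1/4.\<close>

lemma curvature_average_connection:
  fixes nabla nabla' :: "'a::{t2_space,second_countable_topology} connection"
  assumes "linear_connection A nabla" "linear_connection A nabla'"
    and "X \<in> vector_fields A" "Y \<in> vector_fields A" "Z \<in> vector_fields A"
  defines "T \<equiv> \<lambda>X Y. nabla' X Y - nabla X Y"
  shows "curvature (average_connection nabla nabla') X Y Z =
    average_curvature nabla nabla' X Y Z - fscale (\<lambda>p. 1 / 4) (T X (T Y Z) - T Y (T X Z))"
proof -
  interpret N: linear_connection A nabla by fact
  interpret N': linear_connection A nabla' by fact
  note fields = assms(3-5) N.nabla_field N'.nabla_field N.vector_fields_add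
    N.vector_fields_diff N.vector_fields_scale
  show ?thesis
    \<comment> \<open>Additivity in the last slot reduces both sides to iterated derivatives of
      \<open>Z\<close>, compared pointwise. The terms with \<open>lie_bracket X Y\<close> have
      weight 1/2 on both sides and cancel as they stand.\<close>
    by (simp add: fun_eq_iff curvature_def average_connection_def average_curvature_def T_def
        fields N.nabla_add_right N'.nabla_add_right N.nabla_diff_right N'.nabla_diff_right
        N.nabla_scale_right N'.nabla_scale_right field_simps)
qed

section \<open>The almost complex structure and its covariant derivative\<close>

context almost_complex_structure
begin

lemma J_uminus: "v \<in> tangent_space A p \<Longrightarrow> J p (- v) = - J p v"
  using J_scale[of v p "-1"] by (simp add: tscale_minus_one)

lemma J_diff:
  "u \<in> tangent_space A p \<Longrightarrow> v \<in> tangent_space A p \<Longrightarrow> J p (u - v) = J p u - J p v"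
  using J_add[of u p "- v"] by (simp add: J_uminus tangent_space_uminus)

lemma endo_app_square: "X \<in> vector_fields A \<Longrightarrow> endo_app J (endo_app J X) = - X"
  by (simp add: fun_eq_iff J_square vector_fields_tangent)

lemma endo_app_add: "X \<in> vector_fields A \<Longrightarrow> Y \<in> vector_fields A \<Longrightarrow>
    endo_app J (X + Y) = endo_app J X + endo_app J Y"
  by (simp add: fun_eq_iff J_add vector_fields_tangent)

lemma endo_app_diff: "X \<in> vector_fields A \<Longrightarrow> Y \<in> vector_fields A \<Longrightarrow>
    endo_app J (X - Y) = endo_app J X - endo_app J Y"
  by (simp add: fun_eq_iff J_diff vector_fields_tangent)

lemma endo_app_scale: "X \<in> vector_fields A \<Longrightarrow>
    endo_app J (fscale f X) = fscale f (endo_app J X)"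
  by (simp add: fun_eq_iff J_scale vector_fields_tangent)

end

locale almost_complex_connection =
  almost_complex_structure A J + linear_connection A nabla
  for A :: "('a::{t2_space,second_countable_topology}, 'e::euclidean_space) chart set"
    and J :: "'a \<Rightarrow> 'a tvec \<Rightarrow> 'a tvec"
    and nabla :: "'a connection"
begin

lemma cov_deriv_endo_field:
  "X \<in> vector_fields A \<Longrightarrow> Y \<in> vector_fields A \<Longrightarrow> cov_deriv_endo nabla J X Y \<in> vector_fields A"
  by (simp add: cov_deriv_endo_def vector_fields_diff nabla_field J_smooth)

lemma cov_deriv_endo_add_left:
  assumes "X \<in> vector_fields A" "X' \<in> vector_fields A" "Y \<in> vector_fields A"
  shows "cov_deriv_endo nabla J (X + X') Y = cov_deriv_endo nabla J X Y + cov_deriv_endo nabla J X' Y"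
  using assms by (simp add: cov_deriv_endo_def nabla_add_left endo_app_add nabla_field J_smooth)

lemma cov_deriv_endo_scale_left:
  assumes "f \<in> smooth_functions A" "X \<in> vector_fields A" "Y \<in> vector_fields A"
  shows "cov_deriv_endo nabla J (fscale f X) Y = fscale f (cov_deriv_endo nabla J X Y)"
  using assms
  by (simp add: cov_deriv_endo_def nabla_scale_left endo_app_scale nabla_field J_smooth)
    (simp add: fun_eq_iff algebra_simps)

lemma cov_deriv_endo_add_right:
  assumes "X \<in> vector_fields A" "Y \<in> vector_fields A" "Y' \<in> vector_fields A"
  shows "cov_deriv_endo nabla J X (Y + Y') = cov_deriv_endo nabla J X Y + cov_deriv_endo nabla J X Y'"
  using assms by (simp add: cov_deriv_endo_def nabla_add_right endo_app_add nabla_field J_smooth)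

text \<open>Both \<open>nabla X (endo_app J (fscale f Y))\<close> and
  \<open>endo_app J (nabla X (fscale f Y))\<close> contribute the same term (X f) J Y, which cancels
  in the difference.\<close>

lemma cov_deriv_endo_scale_right:
  assumes "f \<in> smooth_functions A" "X \<in> vector_fields A" "Y \<in> vector_fields A"
  shows "cov_deriv_endo nabla J X (fscale f Y) = fscale f (cov_deriv_endo nabla J X Y)"
proof -
  note tangent = vector_fields_tangent[OF assms(3)]
    vector_fields_tangent[OF nabla_field[OF assms(2,3)]]
  \<comment> \<open>Argued pointwise in the tangent spaces: \<open>endo_app_add\<close> asks for
    summands in \<open>vector_fields\<close>, and closure under scaling is proved above for constant
    factors only.\<close>
  have "endo_app J (nabla X (fscale f Y)) =
      fscale (deriv_along X f) (endo_app J Y) + fscale f (endo_app J (nabla X Y))"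
    using assms tangent
    by (simp add: nabla_leibniz fun_eq_iff J_add J_scale tangent_space_scale)
  then show ?thesis
    using assms
    by (simp add: cov_deriv_endo_def endo_app_scale nabla_leibniz J_smooth)
      (simp add: fun_eq_iff algebra_simps)
qed

text \<open>A connection plus a tensor is a connection: the added term is linear over smooth
  functions in both slots, so the Leibniz term comes from \<open>nabla\<close> alone.\<close>

lemma linear_connection_conjugate: "linear_connection A (conjugate_connection J nabla)"
  by unfold_locales
    (simp_all add: conjugate_connection_def nabla_field nabla_add_left nabla_scale_left
      nabla_add_right nabla_leibniz cov_deriv_endo_field cov_deriv_endo_add_left
      cov_deriv_endo_scale_left cov_deriv_endo_add_right cov_deriv_endo_scale_right
      endo_app_add endo_app_scale J_smooth vector_fields_diff,
      simp_all add: fun_eq_iff algebra_simps)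

text \<open>This is the covariant derivative of J^2 = -id.\<close>

lemma cov_deriv_endo_anticommute:
  assumes "X \<in> vector_fields A" "Y \<in> vector_fields A"
  shows "cov_deriv_endo nabla J X (endo_app J Y) = - endo_app J (cov_deriv_endo nabla J X Y)"
proof -
  have "nabla X (- Y) = - nabla X Y"
    using nabla_scale_right[OF assms, of "-1"]
    by (simp add: fscale_def tscale_minus_one fun_Compl_def)
  then show ?thesis
    using assms
    by (simp add: cov_deriv_endo_def endo_app_diff endo_app_square nabla_field J_smooth)
qed

lemma conjugate_difference_compose:
  assumes "X \<in> vector_fields A" "Y \<in> vector_fields A" "Z \<in> vector_fields A"
  defines "T \<equiv> \<lambda>X Y. conjugate_connection J nabla X Y - nabla X Y"
  shows "T X (T Y Z) = cov_deriv_endo nabla J X (cov_deriv_endo nabla J Y Z)"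
proof -
  let ?N = "cov_deriv_endo nabla J"
  \<comment> \<open>The minus sign is written as a constant factor on the argument, so that the
    scaling rules can pull it out; in the composition the two signs cancel.\<close>
  have T: "T X Y = endo_app J (?N X (fscale (\<lambda>p. -1) Y))"
    if "X \<in> vector_fields A" "Y \<in> vector_fields A" for X Y
    using that
    by (simp add: T_def conjugate_connection_def cov_deriv_endo_scale_right const_smooth
        endo_app_scale cov_deriv_endo_field) (simp add: fun_eq_iff)
  have "T X (T Y Z) = endo_app J (?N X (endo_app J (?N Y Z)))"
    using assms(1-3)
    by (simp add: T vector_fields_scale cov_deriv_endo_field J_smooth cov_deriv_endo_scale_right
        endo_app_scale const_smooth) (simp add: fun_eq_iff)
  \<comment> \<open>Anticommuting the inner J past \<open>?N X\<close> leaves -J^2 = id in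
    front.\<close>
  also have "\<dots> = ?N X (?N Y Z)"
    using assms(1-3)
    by (simp add: cov_deriv_endo_anticommute cov_deriv_endo_field fun_eq_iff J_uminus J_square
        J_tangent vector_fields_tangent)
  finally show ?thesis .
qed

end

section \<open>Pairing vector fields with the Norden metric\<close>

context pseudo_riemannian_metric
begin

lemma metric_app_sym: "X \<in> vector_fields A \<Longrightarrow> Y \<in> vector_fields A \<Longrightarrow>
    metric_app g X Y = metric_app g Y X"
  by (simp add: metric_app_def fun_eq_iff g_sym vector_fields_tangent)

lemma metric_app_add_left: "X \<in> vector_fields A \<Longrightarrow> Y \<in> vector_fields A \<Longrightarrow>
    Z \<in> vector_fields A \<Longrightarrow> metric_app g (X + Y) Z = metric_app g X Z + metric_app g Y Z"
  by (simp add: metric_app_def fun_eq_iff g_add vector_fields_tangent)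

lemma metric_app_diff_left: "X \<in> vector_fields A \<Longrightarrow> Y \<in> vector_fields A \<Longrightarrow>
    Z \<in> vector_fields A \<Longrightarrow> metric_app g (X - Y) Z = metric_app g X Z - metric_app g Y Z"
  using metric_app_add_left[of "X - Y" Y Z] vector_fields_diff[of X Y] by simp

lemma metric_app_scale_left: "X \<in> vector_fields A \<Longrightarrow> Y \<in> vector_fields A \<Longrightarrow>
    metric_app g (fscale f X) Y = f * metric_app g X Y"
  by (simp add: metric_app_def fun_eq_iff g_scale vector_fields_tangent)

end

text \<open>Apply the Norden condition to JX and Y, and use J^2 = -id. The sign is opposite to the
  Hermitian case, where J is skew.\<close>

lemma (in almost_norden_manifold) metric_app_J:
  assumes "X \<in> vector_fields A" "Y \<in> vector_fields A"
  shows "metric_app g (endo_app J X) Y = metric_app g X (endo_app J Y)"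
proof
  fix p
  note tangent = assms[THEN vector_fields_tangent, of p]
  have "g p (- X p) (J p (Y p)) = - g p (J p (X p)) (Y p)"
    using norden[of "J p (X p)" p "Y p"] tangent by (simp add: J_tangent J_square)
  moreover have "g p (- X p) (J p (Y p)) = - g p (X p) (J p (Y p))"
    using g_scale[of "X p" p "J p (Y p)" "-1"] tangent by (simp add: J_tangent tscale_minus_one)
  ultimately show "metric_app g (endo_app J X) Y p = metric_app g X (endo_app J Y) p"
    by (simp add: metric_app_def)
qed

section \<open>The Levi-Civita connection of a Norden metric\<close>

locale norden_levi_civita =
  almost_norden_manifold A J g n + levi_civita_connection A g nabla
  for A :: "('a::{t2_space,second_countable_topology}, 'e::euclidean_space) chart set"
    and J :: "'a \<Rightarrow> 'a tvec \<Rightarrow> 'a tvec"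
    and g :: "'a \<Rightarrow> 'a tvec \<Rightarrow> 'a tvec \<Rightarrow> real"
    and n :: nat
    and nabla :: "'a connection"
begin

sublocale almost_complex_connection A J nabla ..

text \<open>Differentiate g(JY, Z) = g(Y, JZ) along X by metric compatibility, then move J across
  the metric in the terms where it acts on an undifferentiated field.\<close>

lemma cov_deriv_endo_self_adjoint:
  assumes "X \<in> vector_fields A" "Y \<in> vector_fields A" "Z \<in> vector_fields A"
  shows "metric_app g (cov_deriv_endo nabla J X Y) Z = metric_app g Y (cov_deriv_endo nabla J X Z)"
proof -
  have "metric_app g (nabla X (endo_app J Y)) Z + metric_app g (endo_app J Y) (nabla X Z) =
      deriv_along X (metric_app g (endo_app J Y) Z)"
    using assms by (simp add: metric_compatible J_smooth)
  also have "\<dots> = deriv_along X (metric_app g Y (endo_app J Z))"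
    using assms by (simp add: metric_app_J)
  also have "\<dots> = metric_app g (nabla X Y) (endo_app J Z) + metric_app g Y (nabla X (endo_app J Z))"
    using assms by (simp add: metric_compatible J_smooth)
  finally have "metric_app g (nabla X (endo_app J Y)) Z - metric_app g (nabla X Y) (endo_app J Z) =
      metric_app g Y (nabla X (endo_app J Z)) - metric_app g (endo_app J Y) (nabla X Z)"
    by (simp add: algebra_simps)
  \<comment> \<open>The rule for differences is stated for the left slot of the metric, so the
    arguments are swapped before \<open>cov_deriv_endo\<close> is expanded.\<close>
  moreover have "metric_app g Y (cov_deriv_endo nabla J X Z) = metric_app g (cov_deriv_endo nabla J X Z) Y"
    using assms by (simp add: metric_app_sym cov_deriv_endo_field)
  ultimately show ?thesis
    using assms
    by (simp add: cov_deriv_endo_def metric_app_diff_left metric_app_J metric_app_sym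
        nabla_field J_smooth)
qed

end

theorem proposition3p1:
  fixes A :: "('a::{t2_space,second_countable_topology}, 'e::euclidean_space) chart set"
    and J :: "'a \<Rightarrow> 'a tvec \<Rightarrow> 'a tvec"
    and g :: "'a \<Rightarrow> 'a tvec \<Rightarrow> 'a tvec \<Rightarrow> real"
    and n :: nat
    and nabla0 nablas D :: "'a connection"
    and P K :: "'a vfield \<Rightarrow> 'a vfield \<Rightarrow> 'a vfield \<Rightarrow> 'a vfield"
  assumes "almost_norden_manifold A J g n"
    and "levi_civita_connection A g nabla0"
    and "nablas = conjugate_connection J nabla0"
    and "P = average_curvature nabla0 nablas"
    and "D = average_connection nabla0 nablas"
    and "K = curvature D"
  shows "\<forall>X\<in>vector_fields A. \<forall>Y\<in>vector_fields A. \<forall>Z\<in>vector_fields A. \<forall>W\<in>vector_fields A. \<forall>p.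
    metric_app g (K X Y Z) W p =
      metric_app g (P X Y Z) W p +
      1 / 4 * (metric_app g (cov_deriv_endo nabla0 J X Z) (cov_deriv_endo nabla0 J Y W) p -
               metric_app g (cov_deriv_endo nabla0 J X W) (cov_deriv_endo nabla0 J Y Z) p)"
proof (intro ballI allI)
  fix X Y Z W p
  assume fields: "X \<in> vector_fields A" "Y \<in> vector_fields A" "Z \<in> vector_fields A"
    "W \<in> vector_fields A"
  interpret norden_levi_civita A J g n nabla0
    using assms(1,2) by (simp add: norden_levi_civita_def)
  interpret S: linear_connection A nablas
    unfolding assms(3) by (rule linear_connection_conjugate)
  let ?N = "cov_deriv_endo nabla0 J"
  have N: "?N X Z \<in> vector_fields A" "?N Y Z \<in> vector_fields A"
      "?N X (?N Y Z) \<in> vector_fields A" "?N Y (?N X Z) \<in> vector_fields A"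
    using fields by (simp_all add: cov_deriv_endo_field)
  \<comment> \<open>Torsion-freeness exhibits the bracket as a difference of two smooth
    fields.\<close>
  have "lie_bracket X Y \<in> vector_fields A"
    using fields by (simp add: torsion_free[symmetric] vector_fields_diff nabla_field)
  then have P: "P X Y Z \<in> vector_fields A"
    using fields
    by (simp add: assms(4) average_curvature_def curvature_def vector_fields_add
        vector_fields_diff vector_fields_scale nabla_field S.nabla_field)
  have "K X Y Z = P X Y Z - fscale (\<lambda>p. 1 / 4) (?N X (?N Y Z) - ?N Y (?N X Z))"
    using curvature_average_connection[OF linear_connection_axioms S.linear_connection_axioms
        fields(1-3)] fields
    by (simp add: assms(3-6) conjugate_difference_compose)
  then have "metric_app g (K X Y Z) W p = metric_app g (P X Y Z) W p -
      1 / 4 * (metric_app g (?N X (?N Y Z)) W p - metric_app g (?N Y (?N X Z)) W p)"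
    using fields(4) N P
    by (simp add: metric_app_diff_left metric_app_scale_left vector_fields_diff vector_fields_scale)
  \<comment> \<open>Self-adjointness carries the outer \<open>?N X\<close> over to \<open>W\<close>;
    symmetry then restores the order of the claim. The leading factor -1/4 accounts for the exchange
    of the two terms at the end.\<close>
  moreover have "metric_app g (?N X (?N Y Z)) W = metric_app g (?N X W) (?N Y Z)"
    using fields N by (simp add: cov_deriv_endo_self_adjoint metric_app_sym cov_deriv_endo_field)
  moreover have "metric_app g (?N Y (?N X Z)) W = metric_app g (?N X Z) (?N Y W)"
    using fields N by (simp add: cov_deriv_endo_self_adjoint)
  ultimately show "metric_app g (K X Y Z) W p = metric_app g (P X Y Z) W p +
      1 / 4 * (metric_app g (?N X Z) (?N Y W) p - metric_app g (?N X W) (?N Y Z) p)"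
    by (simp add: algebra_simps)
qed

end
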